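(* For the Santa Claus problem on $m$ identical machines, $\textsc{Greedy}$ has online bounded ratio $1$.
   Context: Santa Claus problem: jobs with positive sizes arrive online and each must be assigned irrevocably to one of $m$ identical machines; the load of a machine is the total size of its jobs; the goal is to maximize the minimum load over all machines. $\textsc{Greedy}$ assigns each new job to a machine of minimum current load (ties arbitrary). For a deterministic online algorithm $A$ of a maximization problem, $\textsc{Opt}_A$ denotes an offline algorithm that is optimal among offline algorithms whose solution on any input $I$ satisfies, for every prefix $I'$ of $I$, that the value of the solution restricted to $I'$ is at least $A(I')$. The online bounded ratio of $A$ is the supremum of all constants $c$ such that $A(I) \ge c\,\textsc{Opt}_A(I)$ for all inputs $I$. *)

theory Defs imports Complex_Main begin

text \<open>
  An input is the list of job sizes in order of arrival. A solution for the input \<open>I\<close> on machines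
  \<open>0, \<dots>, m - 1\<close> is a list of the same length whose \<open>j\<close>-th entry is the machine of the
  \<open>j\<close>-th job, so \<open>take k\<close> restricts a solution to the first \<open>k\<close> jobs.
\<close>

definition valid_input :: "real list \<Rightarrow> bool" where
  "valid_input I \<longleftrightarrow> (\<forall>x\<in>set I. 0 < x)"

definition is_solution :: "nat \<Rightarrow> real list \<Rightarrow> nat list \<Rightarrow> bool" where
  "is_solution m I s \<longleftrightarrow> length s = length I \<and> set s \<subseteq> {..<m}"

definition load :: "real list \<Rightarrow> nat list \<Rightarrow> nat \<Rightarrow> real" where
  "load I s i = (\<Sum>j | j < length I \<and> s ! j = i. I ! j)"

definition min_load :: "nat \<Rightarrow> real list \<Rightarrow> nat list \<Rightarrow> real" where
  "min_load m I s = Min (load I s ` {..<m})"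

text \<open>
  A deterministic online algorithm maps the jobs seen so far to the machine of the most recent one.
  Its earlier decisions are determined by the same jobs, hence need not be passed separately.
\<close>

definition online_algorithm :: "nat \<Rightarrow> (real list \<Rightarrow> nat) \<Rightarrow> bool" where
  "online_algorithm m A \<longleftrightarrow> (\<forall>I. valid_input I \<longrightarrow> I \<noteq> [] \<longrightarrow> A I < m)"

definition run :: "(real list \<Rightarrow> nat) \<Rightarrow> real list \<Rightarrow> nat list" where
  "run A I = map (\<lambda>k. A (take (Suc k) I)) [0..<length I]"

text \<open>
  A predicate rather than a function: every tie-breaking rule gives a Greedy algorithm.
\<close>

definition greedy :: "nat \<Rightarrow> (real list \<Rightarrow> nat) \<Rightarrow> bool" where
  "greedy m A \<longleftrightarrow> online_algorithm m A \<and>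
     (\<forall>I x. valid_input (I @ [x]) \<longrightarrow>
        (\<forall>i<m. load I (run A I) (A (I @ [x])) \<le> load I (run A I) i))"

definition online_bounded :: "nat \<Rightarrow> (real list \<Rightarrow> nat) \<Rightarrow> (real list \<Rightarrow> nat list) \<Rightarrow> bool" where
  "online_bounded m A B \<longleftrightarrow> (\<forall>I. valid_input I \<longrightarrow>
     is_solution m I (B I) \<and>
     (\<forall>k\<le>length I. min_load m (take k I) (take k (B I))
                    \<ge> min_load m (take k I) (run A (take k I))))"

definition is_Opt :: "nat \<Rightarrow> (real list \<Rightarrow> nat) \<Rightarrow> (real list \<Rightarrow> nat list) \<Rightarrow> bool" where
  "is_Opt m A B \<longleftrightarrow> online_bounded m A B \<and>
     (\<forall>B'. online_bounded m A B' \<longrightarrow>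
        (\<forall>I. valid_input I \<longrightarrow> min_load m I (B' I) \<le> min_load m I (B I)))"

text \<open>
  Such an algorithm exists by lemma \<open>ex_is_Opt\<close>, and all of them have the same value
  on every input by lemma \<open>is_Opt_unique_value\<close>, so the choice is immaterial.
\<close>

definition Opt :: "nat \<Rightarrow> (real list \<Rightarrow> nat) \<Rightarrow> real list \<Rightarrow> nat list" where
  "Opt m A = (SOME B. is_Opt m A B)"

definition online_bounded_ratio :: "nat \<Rightarrow> (real list \<Rightarrow> nat) \<Rightarrow> real" where
  "online_bounded_ratio m A =
     Sup {c. \<forall>I. valid_input I \<longrightarrow> min_load m I (run A I) \<ge> c * min_load m I (Opt m A I)}"

lemma take_run: "take k (run A I) = run A (take k I)"
  by (rule nth_equalityI) (auto simp: run_def)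

lemma is_solution_run:
  assumes "online_algorithm m A" "valid_input I"
  shows "is_solution m I (run A I)"
proof -
  have "A (take (Suc k) I) < m" if "k < length I" for k
  proof -
    have "valid_input (take (Suc k) I)"
      using assms(2) by (auto simp: valid_input_def dest: in_set_takeD)
    moreover have "take (Suc k) I \<noteq> []"
      using that by auto
    ultimately show ?thesis
      using assms(1) by (auto simp: online_algorithm_def)
  qed
  then show ?thesis
    by (auto simp: is_solution_def run_def)
qed

lemma is_Opt_unique_value:
  assumes "is_Opt m A B" "is_Opt m A B'" "valid_input I"
  shows "min_load m I (B I) = min_load m I (B' I)"
  using assms unfolding is_Opt_def by (meson order_antisym)

lemma ex_is_Opt:
  assumes "online_algorithm m A"
  shows "\<exists>B. is_Opt m A B"
proof -
  define F where "F I = {s. is_solution m I s \<and>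
     (\<forall>k\<le>length I. min_load m (take k I) (take k s)
                    \<ge> min_load m (take k I) (run A (take k I)))}" for I
  have "\<exists>s\<in>F I. \<forall>t\<in>F I. min_load m I t \<le> min_load m I s" if "valid_input I" for I
  proof -
    have "F I \<subseteq> {s. set s \<subseteq> {..<m} \<and> length s = length I}"
      by (auto simp: F_def is_solution_def)
    then have fin: "finite (F I)"
      using finite_lists_length_eq[of "{..<m}"] by (auto intro: finite_subset)
    have ne: "run A I \<in> F I"
      using is_solution_run[OF assms that] by (simp add: F_def take_run)
    have "Max (min_load m I ` F I) \<in> min_load m I ` F I"
      using fin ne by (intro Max_in) auto
    then obtain s where "s \<in> F I" "min_load m I s = Max (min_load m I ` F I)"
      by auto
    then show ?thesis
      using fin by (intro bexI[of _ s]) auto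
  qed
  then have "\<forall>I. \<exists>s. valid_input I \<longrightarrow>
      s \<in> F I \<and> (\<forall>t\<in>F I. min_load m I t \<le> min_load m I s)"
    by blast
  from choice[OF this] obtain B where B: "\<And>I. valid_input I \<Longrightarrow> B I \<in> F I"
      "\<And>I t. valid_input I \<Longrightarrow> t \<in> F I \<Longrightarrow> min_load m I t \<le> min_load m I (B I)"
    by blast
  have bounded: "online_bounded m A C \<longleftrightarrow> (\<forall>I. valid_input I \<longrightarrow> C I \<in> F I)" for C
    unfolding online_bounded_def F_def by simp
  have "is_Opt m A B"
    using B unfolding is_Opt_def bounded by blast
  then show ?thesis by blast
qed

end

theory Submission imports Defs "HOL-Library.Multiset" begin

text \<open>
  Compare the multisets \<open>M\<close> and \<open>N\<close> of machine loads of Greedy and of a solution that is at least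
  as good on every prefix, and let \<open>L\<close> be the minimum of \<open>M\<close>. As long as several Greedy machines
  have load \<open>L\<close>, Greedy fills one of them per job without raising the minimum; the other solution
  either does the same up to renaming machines, or it falls behind and has more machines of load
  \<open>L\<close> than Greedy. In the latter case some of its machines still have load \<open>L\<close> when Greedy's
  minimum rises, a contradiction. Hence at any time \<open>M = N\<close> or \<open>N\<close> contains \<open>L\<close> more often
  than \<open>M\<close>, and in both cases the minimum of \<open>N\<close> is at most \<open>L\<close>.
\<close>

text \<open>The machines are identical, so a multiset is the right state: solutions that differ by
  renaming machines become equal.\<close>

definition loads :: "nat \<Rightarrow> real list \<Rightarrow> nat list \<Rightarrow> real multiset" where
  "loads m I s = image_mset (load I s) (mset_set {..<m})"

definition not_ahead :: "real multiset \<Rightarrow> real multiset \<Rightarrow> bool" where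
  "not_ahead N M \<longleftrightarrow> N = M \<or> count M (Min_mset M) < count N (Min_mset M)"

lemma set_mset_loads: "set_mset (loads m I s) = load I s ` {..<m}"
  by (simp add: loads_def)

lemma min_load_eq_Min_mset: "min_load m I s = Min_mset (loads m I s)"
  by (simp add: min_load_def set_mset_loads)

lemma load_snoc:
  assumes "length s = length I"
  shows "load (I @ [x]) (s @ [a]) i = load I s i + (if a = i then x else 0)"
proof -
  have jobs: "{j. j < length (I @ [x]) \<and> (s @ [a]) ! j = i} =
      {j. j < length I \<and> s ! j = i} \<union> (if a = i then {length I} else {})"
    using assms by (auto simp: nth_append less_Suc_eq)
  moreover have "(\<Sum>j | j < length I \<and> s ! j = i. (I @ [x]) ! j) = load I s i"
    unfolding load_def by (intro sum.cong) (auto simp: nth_append)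
  ultimately show ?thesis
    unfolding load_def jobs by (subst sum.union_disjoint) auto
qed

lemma loads_snoc:
  assumes "length s = length I" and "a < m"
  shows "loads m (I @ [x]) (s @ [a]) =
    add_mset (load I s a + x) (loads m I s - {#load I s a#})"
proof -
  have split: "mset_set {..<m} = add_mset a (mset_set ({..<m} - {a}))"
    using assms(2) by (subst mset_set.remove[of _ a]) auto
  have "image_mset (load (I @ [x]) (s @ [a])) (mset_set ({..<m} - {a})) =
      image_mset (load I s) (mset_set ({..<m} - {a}))"
    by (intro image_mset_cong) (auto simp: load_snoc[OF assms(1)])
  then show ?thesis
    by (simp add: loads_def split load_snoc[OF assms(1)])
qed

lemma Min_mset_le_if_not_ahead:
  assumes "not_ahead N M"
  shows "Min_mset N \<le> Min_mset M"
proof (cases "N = M")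
  case False
  then have "Min_mset M \<in># N"
    using assms unfolding not_ahead_def
    by (metis count_greater_zero_iff gr_implies_not0 not_gr_zero)
  then show ?thesis by simp
qed simp

lemma not_ahead_step:
  fixes M N :: "real multiset"
  defines "L \<equiv> Min_mset M"
  assumes "M \<noteq> {#}" and "not_ahead N M" and "a \<in># N" and "0 < x"
    and M': "M' = add_mset (L + x) (M - {#L#})"
    and N': "N' = add_mset (a + x) (N - {#a#})"
    and min: "Min_mset M' \<le> Min_mset N'"
  shows "not_ahead N' M'"
proof (cases "N = M \<and> a = L")
  case True
  then show ?thesis by (simp add: not_ahead_def M' N')
next
  case False
  have L: "L \<in># M" "\<And>y. y \<in># M \<Longrightarrow> L \<le> y"
    using \<open>M \<noteq> {#}\<close> by (auto simp: L_def)
  have countM: "Suc (count M' L) = count M L"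
    using L(1) \<open>0 < x\<close> by (simp add: M')
  \<comment> \<open>If \<open>N = M\<close>, then \<open>a\<close> differs from \<open>L\<close>, so
    \<open>N'\<close> keeps every copy of \<open>L\<close> while Greedy uses one up. Otherwise the
    strict gap survives, since \<open>N\<close> loses at most one copy as well.\<close>
  have less: "count M' L < count N' L"
  proof (cases "N = M")
    case True
    then show ?thesis
      using False countM by (auto simp: N')
  next
    case neq: False
    have "count N L \<le> Suc (count N' L)"
      by (auto simp: N')
    then show ?thesis
      using \<open>not_ahead N M\<close> neq countM by (simp add: not_ahead_def L_def)
  qed
  \<comment> \<open>Prefix domination enters here: as \<open>N'\<close> still contains
    \<open>L\<close>, the minimum of \<open>M'\<close> cannot have risen above \<open>L\<close>. It
    therefore equals \<open>L\<close>, the value at which \<open>less\<close> compares the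
    counts.\<close>
  have "L \<in># N'"
    using less by (metis count_greater_zero_iff gr_implies_not0 not_gr_zero)
  then have "Min_mset M' \<le> L"
    using min by (meson Min_le finite_set_mset order_trans)
  moreover have "L \<le> Min_mset M'"
    using L(2) \<open>0 < x\<close> by (auto simp: M' dest: in_diffD)
  ultimately show ?thesis
    using less by (simp add: not_ahead_def)
qed

lemma run_snoc: "run A (I @ [x]) = run A I @ [A (I @ [x])]"
  by (simp add: run_def)

lemma length_run [simp]: "length (run A I) = length I"
  by (simp add: run_def)

lemma valid_input_snoc: "valid_input (I @ [x]) \<longleftrightarrow> valid_input I \<and> 0 < x"
  by (auto simp: valid_input_def)

text \<open>Ties leave no trace in the multiset: whichever least loaded machine is chosen, one copy
  of the minimum grows by \<open>x\<close>.\<close>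

lemma greedy_loads_snoc:
  assumes "greedy m A" and "valid_input (I @ [x])"
  defines "M \<equiv> loads m I (run A I)"
  shows "loads m (I @ [x]) (run A (I @ [x])) = add_mset (Min_mset M + x) (M - {#Min_mset M#})"
proof -
  have a: "A (I @ [x]) < m"
    using assms by (auto simp: greedy_def online_algorithm_def)
  have "Min_mset M = load I (run A I) (A (I @ [x]))"
    using assms(1,2) a unfolding M_def set_mset_loads
    by (intro Min_eqI) (auto simp: greedy_def)
  then show ?thesis
    using a by (simp add: run_snoc loads_snoc M_def)
qed

lemma not_ahead_of_greedy:
  assumes "m \<ge> 1" and "greedy m A" and "valid_input I" and "is_solution m I s"
    and "\<forall>k\<le>length I. min_load m (take k I) (run A (take k I)) \<le> min_load m (take k I) (take k s)"
  shows "not_ahead (loads m I s) (loads m I (run A I))"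
  using assms(3-)
proof (induction I arbitrary: s rule: rev_induct)
  case Nil
  then show ?case by (simp add: not_ahead_def is_solution_def run_def)
next
  case (snoc x I)
  obtain s' a where s: "s = s' @ [a]" and len: "length s' = length I"
    using snoc.prems(2) by (cases s rule: rev_cases) (auto simp: is_solution_def)
  have sol: "is_solution m I s'" and a: "a < m"
    using snoc.prems(2) len by (auto simp: s is_solution_def)
  have val: "valid_input I" "0 < x"
    using snoc.prems(1) by (auto simp: valid_input_snoc)
  \<comment> \<open>Domination on the prefixes of \<open>I\<close> feeds the induction hypothesis;
    the remaining case, the whole of \<open>I @ [x]\<close>, supplies the last premise of
    \<open>not_ahead_step\<close>.\<close>
  have "min_load m (take k I) (run A (take k I)) \<le> min_load m (take k I) (take k s')"
    if "k \<le> length I" for k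
    using snoc.prems(3)[rule_format, of k] that len by (simp add: s)
  then have IH: "not_ahead (loads m I s') (loads m I (run A I))"
    using snoc.IH val sol by blast
  show ?case
  proof (rule not_ahead_step[OF _ IH _ val(2) greedy_loads_snoc[OF assms(2) snoc.prems(1)]])
    show "loads m I (run A I) \<noteq> {#}"
      using assms(1) by (auto simp: loads_def mset_set_empty_iff lessThan_empty_iff)
    show "load I s' a \<in># loads m I s'"
      using a by (simp add: set_mset_loads)
    show "loads m (I @ [x]) s = add_mset (load I s' a + x) (loads m I s' - {#load I s' a#})"
      unfolding s by (rule loads_snoc[OF len a])
    show "Min_mset (loads m (I @ [x]) (run A (I @ [x]))) \<le> Min_mset (loads m (I @ [x]) s)"
      using snoc.prems(3)[rule_format, of "length (I @ [x])"] len
      by (simp add: min_load_eq_Min_mset s)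
  qed
qed

lemma min_load_Opt_greedy:
  assumes "m \<ge> 1" and "greedy m A" and "valid_input I"
  shows "min_load m I (Opt m A I) = min_load m I (run A I)"
proof -
  have "is_Opt m A (Opt m A)"
    unfolding Opt_def using assms(2) by (intro someI_ex[OF ex_is_Opt]) (simp add: greedy_def)
  then have "online_bounded m A (Opt m A)"
    by (simp add: is_Opt_def)
  then have sol: "is_solution m I (Opt m A I)"
    and dom: "\<forall>k\<le>length I. min_load m (take k I) (run A (take k I))
                \<le> min_load m (take k I) (take k (Opt m A I))"
    using assms(3) by (simp_all add: online_bounded_def)
  have "min_load m I (run A I) \<le> min_load m I (Opt m A I)"
    using dom[rule_format, of "length I"] sol by (simp add: is_solution_def)
  moreover have "min_load m I (Opt m A I) \<le> min_load m I (run A I)"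
    unfolding min_load_eq_Min_mset
    by (intro Min_mset_le_if_not_ahead not_ahead_of_greedy assms sol dom)
  ultimately show ?thesis by simp
qed

lemma load_nonneg: "valid_input I \<Longrightarrow> 0 \<le> load I s i"
  unfolding load_def valid_input_def by (intro sum_nonneg) (auto intro: less_imp_le)

lemma min_load_nonneg:
  assumes "m \<ge> 1" and "valid_input I"
  shows "0 \<le> min_load m I s"
  unfolding min_load_def using assms by (subst Min_ge_iff) (auto simp: load_nonneg lessThan_empty_iff)

text \<open>While some machine is empty the minimum is 0, so each unit job occupies an empty
  machine. Truncated subtraction covers the jobs after the first \<open>m\<close>.\<close>

lemma count_idle_greedy_replicate:
  assumes "greedy m A"
  shows "count (loads m (replicate n 1) (run A (replicate n 1))) 0 \<le> m - n"
proof (induction n)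
  case 0
  have "count (loads m [] (run A [])) 0 \<le> size (loads m [] (run A []))"
    by (rule count_le_size)
  then show ?case by (simp add: loads_def)
next
  case (Suc n)
  define I :: "real list" where "I = replicate n 1"
  define M where "M = loads m I (run A I)"
  have val: "valid_input (I @ [1])"
    by (auto simp: I_def valid_input_def)
  have nonneg: "\<forall>y\<in>#M. 0 \<le> y"
    using val by (auto simp: M_def set_mset_loads valid_input_snoc load_nonneg)
  have "A (I @ [1]) < m"
    using assms val by (auto simp: greedy_def online_algorithm_def)
  then have ne: "M \<noteq> {#}"
    by (auto simp: M_def loads_def mset_set_empty_iff lessThan_empty_iff)
  then have "0 \<le> Min_mset M"
    using nonneg by simp
  moreover have "Min_mset M = 0" if "0 \<in># M"
    using that nonneg by (intro Min_eqI) auto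
  ultimately have "count (add_mset (Min_mset M + 1) (M - {#Min_mset M#})) 0 \<le> count M 0 - 1"
    by (cases "0 \<in># M") (auto simp: not_in_iff)
  moreover have "replicate (Suc n) 1 = I @ [1]"
    by (simp add: I_def replicate_append_same)
  ultimately show ?case
    using Suc greedy_loads_snoc[OF assms val] by (simp add: M_def I_def)
qed

text \<open>An input of positive value is what bounds the ratio from above: inputs of value 0 admit
  every constant \<open>c\<close>.\<close>

lemma greedy_min_load_replicate_pos:
  assumes "m \<ge> 1" and "greedy m A"
  shows "0 < min_load m (replicate m 1) (run A (replicate m 1))"
proof -
  let ?I = "replicate m 1 :: real list"
  have "0 \<notin># loads m ?I (run A ?I)"
    using count_idle_greedy_replicate[OF assms(2), of m] by (simp add: not_in_iff)
  moreover have "min_load m ?I (run A ?I) \<in># loads m ?I (run A ?I)"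
    unfolding min_load_eq_Min_mset using assms(1) by (intro Min_in) (auto simp: set_mset_loads lessThan_empty_iff)
  moreover have "0 \<le> min_load m ?I (run A ?I)"
    using assms(1) by (intro min_load_nonneg) (auto simp: valid_input_def)
  ultimately show ?thesis
    by (metis order_le_less)
qed

theorem theorem6:
  fixes m :: nat and A :: "real list \<Rightarrow> nat"
  assumes "m \<ge> 1" and "greedy m A"
  shows "online_bounded_ratio m A = 1"
proof -
  let ?I = "replicate m 1 :: real list"
  have val: "valid_input ?I"
    by (auto simp: valid_input_def)
  show ?thesis
    unfolding online_bounded_ratio_def
  proof (rule cSup_eq_maximum)
    show "1 \<in> {c. \<forall>I. valid_input I \<longrightarrow> c * min_load m I (Opt m A I) \<le> min_load m I (run A I)}"
      by (simp add: min_load_Opt_greedy[OF assms])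
  next
    fix c
    assume "c \<in> {c. \<forall>I. valid_input I \<longrightarrow> c * min_load m I (Opt m A I) \<le> min_load m I (run A I)}"
    \<comment> \<open>Opt and Greedy have the same value on \<open>?I\<close>, and this value is
      positive, so it cancels.\<close>
    then have "c * min_load m ?I (run A ?I) \<le> min_load m ?I (run A ?I)"
      using val by (metis (mono_tags, lifting) mem_Collect_eq min_load_Opt_greedy[OF assms])
    then show "c \<le> 1"
      using greedy_min_load_replicate_pos[OF assms] by simp
  qed
qed

end
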